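(* For every integer $n\geq 2$ and every real number $a>0$ there exists a symplectic embedding $\psi:B^{2n}_1\to B^2_1\times\mathbb{R}^{2n-2}$ such that for every $z\in\mathbb{R}^{2n-2}$ the bounded hull of the section $\iota_z^{-1}\big(\psi\big(B^{2n}_1\big)\big)\subseteq\mathbb{R}^2$ has area at most $a$.
   Context: The standard coordinates on $\mathbb{R}^{2n}$ are denoted, in this order, by $q^1,p_1,\ldots,q^n,p_n$ (upper and lower indices, not powers). $\mathbb{R}^{2n}$ and its open subsets are equipped with the standard symplectic form $\omega_0:=\sum_{i=1}^n dq^i\wedge dp_i$. A symplectic embedding between open subsets of $\mathbb{R}^{2n}$ is a smooth embedding that pulls back $\omega_0$ to $\omega_0$. $B^m_r$ denotes the open ball in $\mathbb{R}^m$ of radius $r$ around $0$. For $z\in\mathbb{R}^{2n-2}$ the map $\iota_z:\mathbb{R}^2\to\mathbb{R}^{2n}$ is defined by $\iota_z(y):=(y,z)$. For a bounded subset $S$ of $\mathbb{R}^m$, the bounded hull of $S$ is the union of $S$ and all bounded connected components of $\mathbb{R}^m\setminus S$. Area means two-dimensional Lebesgue measure. *)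

theory Defs
  imports "HOL-Analysis.Analysis"
begin

text \<open>The plane carries the coordinates \<open>(q, p)\<close>. The space \<open>\<real>\<^sup>2\<^sup>n\<close> is split as
  \<open>\<real>\<^sup>2 \<times> \<real>\<^sup>2\<^sup>n\<^sup>-\<^sup>2\<close>, where the first factor has the coordinates \<open>(q\<^sup>1, p\<^sub>1)\<close> and the
  second one is indexed by a finite type \<open>'m\<close> with \<open>n - 1\<close> elements. A free type variable
  \<open>'m :: finite\<close> therefore ranges over exactly the dimensions \<open>2n\<close> with \<open>n = CARD('m) + 1 \<ge> 2\<close>.
  The library norms on products and on \<open>_ ^ 'm\<close> are the Euclidean ones.\<close>

type_synonym plane = "real \<times> real"
type_synonym 'm phase_space = "plane \<times> (plane ^ 'm)"

definition wedge :: "('v \<Rightarrow> real) \<Rightarrow> ('v \<Rightarrow> real) \<Rightarrow> 'v \<Rightarrow> 'v \<Rightarrow> real" where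
  "wedge \<alpha> \<beta> u v = \<alpha> u * \<beta> v - \<alpha> v * \<beta> u"

definition omega0 :: "'m::finite phase_space \<Rightarrow> 'm phase_space \<Rightarrow> real" where
  "omega0 u v =
     wedge (\<lambda>w. fst (fst w)) (\<lambda>w. snd (fst w)) u v +
     (\<Sum>i\<in>UNIV. wedge (\<lambda>w. fst (snd w $ i)) (\<lambda>w. snd (snd w $ i)) u v)"

text \<open>\<open>C_on k S f\<close> is meant for open \<open>S\<close>: \<open>f\<close> is \<open>k\<close> times differentiable on \<open>S\<close>, with
  continuous iterated directional derivatives of order \<open>k\<close>.\<close>

fun C_on :: "nat \<Rightarrow> 'a set \<Rightarrow> ('a::euclidean_space \<Rightarrow> 'b::euclidean_space) \<Rightarrow> bool" where
  "C_on 0 S f \<longleftrightarrow> continuous_on S f"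
| "C_on (Suc k) S f \<longleftrightarrow>
     (\<forall>x\<in>S. f differentiable (at x)) \<and> (\<forall>v. C_on k S (\<lambda>x. frechet_derivative f (at x) v))"

definition smooth_on :: "'a set \<Rightarrow> ('a::euclidean_space \<Rightarrow> 'b::euclidean_space) \<Rightarrow> bool" where
  "smooth_on S f \<longleftrightarrow> (\<forall>k. C_on k S f)"

definition smooth_embedding_on :: "'a set \<Rightarrow> ('a::euclidean_space \<Rightarrow> 'b::euclidean_space) \<Rightarrow> bool" where
  "smooth_embedding_on U f \<longleftrightarrow>
     smooth_on U f \<and>
     (\<forall>x\<in>U. inj (frechet_derivative f (at x))) \<and>
     (\<exists>g. homeomorphism U (f ` U) f g)"

text \<open>A map on \<open>U\<close> is represented by a total function; only its values on \<open>U\<close> matter.\<close>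

definition symplectic_embedding ::
    "'m::finite phase_space set \<Rightarrow> 'm phase_space set \<Rightarrow> ('m phase_space \<Rightarrow> 'm phase_space) \<Rightarrow> bool" where
  "symplectic_embedding U V \<psi> \<longleftrightarrow>
     open U \<and> open V \<and> \<psi> ` U \<subseteq> V \<and> smooth_embedding_on U \<psi> \<and>
     (\<forall>x\<in>U. \<forall>u v. omega0 (frechet_derivative \<psi> (at x) u) (frechet_derivative \<psi> (at x) v) = omega0 u v)"

definition bounded_hull :: "'a::euclidean_space set \<Rightarrow> 'a set" where
  "bounded_hull S = S \<union> \<Union>{C \<in> components (- S). bounded C}"

definition iota :: "plane ^ 'm \<Rightarrow> plane \<Rightarrow> 'm::finite phase_space" where
  "iota z y = (y, z)"

lemma bounded_hull_eq_inside: "bounded_hull S = S \<union> inside S"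
proof -
  have "\<Union>{C \<in> components (- S). bounded C} = inside S"
  proof (intro equalityI subsetI)
    fix x assume "x \<in> \<Union>{C \<in> components (- S). bounded C}"
    then obtain y where y: "bounded (connected_component_set (- S) y)"
        "x \<in> connected_component_set (- S) y"
      by (auto simp: components_def)
    then have "connected_component_set (- S) y = connected_component_set (- S) x"
      using connected_component_eq by blast
    then show "x \<in> inside S"
      using y connected_component_in[of "- S" y x] by (simp add: inside_def)
  next
    fix x assume "x \<in> inside S"
    then have "x \<in> - S" and "bounded (connected_component_set (- S) x)"
      by (auto simp: inside_def)
    then show "x \<in> \<Union>{C \<in> components (- S). bounded C}"
      using connected_component_refl[of x "- S"] by (auto simp: components_def)
  qed
  then show ?thesis
    by (simp add: bounded_hull_def)
qed

text \<open>The hull of a bounded open set is open, so its Lebesgue measure is meaningful.\<close>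

lemma open_bounded_hull:
  fixes S :: "plane set"
  assumes "open S" "bounded S"
  shows "open (bounded_hull S)"
proof -
  have eq: "bounded_hull S = - outside S"
    by (simp add: bounded_hull_eq_inside union_with_inside)
  have "closed (outside S)"
  proof (cases "outside S = {}")
    case False
    then obtain x where x: "x \<in> outside S" by blast
    have "connected (outside S)"
      using assms(2) by (intro connected_outside) auto
    have ss: "outside S \<subseteq> connected_component_set (- S) x"
      by (rule connected_component_maximal[OF x \<open>connected (outside S)\<close>])
         (simp add: outside_def)
    have "connected_component_set (- S) x \<subseteq> outside S"
    proof
      fix y assume "y \<in> connected_component_set (- S) x"
      then have "connected_component_set (- S) y = connected_component_set (- S) x"
        by (rule connected_component_eq)
      with x show "y \<in> outside S"
        by (simp add: outside)
    qed
    with ss have "outside S = connected_component_set (- S) x" by blast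
    then show ?thesis
      using assms(1) closed_connected_component[of "- S" x] by (simp add: closed_Compl)
  qed auto
  then show ?thesis by (simp add: eq open_closed)
qed

end

theory Submission
  imports Defs
begin

text \<open>The time-one Hamiltonian flow of \<open>- k \<bar>y\<bar>\<^sup>2 q\<close>, where \<open>y\<close> is the point of the first plane and \<open>(q, p)\<close> are
  coordinates of one further plane, rotates \<open>y\<close> by the angle \<open>2 k q\<close> and shifts \<open>p\<close> by
  \<open>k \<bar>y\<bar>\<^sup>2\<close>. It preserves the cylinder over the unit disc. In the image of the unit ball, a
  section over a point with \<open>p\<close>-coordinate \<open>c\<close> consists of points with \<open>\<bar>c - k \<bar>y\<bar>\<^sup>2\<bar> < 1\<close>, because
  \<open>\<bar>p\<bar> < 1\<close> on the ball. These lie in an annulus of area at most \<open>2\<pi>/k\<close>, but the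
  bounded hull of a section that winds around the annulus contains the disc inside.

  The hull is controlled by cutting the annuli open. The unit disc minus a radius is
  symplectomorphic to the unit disc: the map
  \<open>(q, p) \<mapsto> (\<integral> 2 sqrt (1 - q\<^sup>2) dq, p / (2 sqrt (1 - q\<^sup>2)))\<close> sends the disc onto a rectangle of area
  \<open>\<pi>\<close>, and such a rectangle becomes, after an area-preserving rescaling, the slit disc if
  its sides are read as half the squared radius and the angle.
  Apply this map to \<open>y\<close> before the flow. The slit is then rotated by the flow, but by
  an angle that depends only on \<open>q\<close>, and \<open>q\<close> is constant on a section. Hence every section avoids
  some ray from the origin. A point outside the annulus lies on a circle around the
  origin that misses the section, and the circle together with the ray joins it to infinity; so the
  hull is still contained in the annulus (\<open>bounded_hull_slit\<close>), and \<open>k = 2\<pi>/a\<close> suffices.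

  The composite of the two maps is \<open>wrap\<close>, which embeds the whole cylinder over the open disc
  (\<open>symplectic_embedding_wrap\<close>): the derivative is injective because the form is nondegenerate,
  and the inverse is continuous by invariance of domain.\<close>

section \<open>Calculus of smooth functions\<close>

lemma frechet_derivative_eq:
  assumes "(f has_derivative f') (at x)"
  shows "frechet_derivative f (at x) = f'"
  using frechet_derivative_at[OF assms] by simp

lemma C_on_Suc_has_derivative:
  assumes "C_on (Suc k) S f" "x \<in> S"
  shows "(f has_derivative frechet_derivative f (at x)) (at x)"
  using assms frechet_derivative_works by auto

lemma C_on_cong:
  assumes "open S" "\<And>x. x \<in> S \<Longrightarrow> f x = g x"
  shows "C_on k S f \<longleftrightarrow> C_on k S g"
proof -
  have "C_on k S g" if "C_on k S f" "\<And>x. x \<in> S \<Longrightarrow> f x = g x" for f g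
    using that
  proof (induction k arbitrary: f g)
    case 0
    then show ?case using continuous_on_cong[OF refl, of S f g] by simp
  next
    case (Suc k)
    have D: "(g has_derivative frechet_derivative f (at x)) (at x)" if "x \<in> S" for x
      by (rule has_derivative_transform_within_open[OF
          C_on_Suc_has_derivative[OF Suc.prems(1) that] assms(1) that Suc.prems(2)])
    have "C_on k S (\<lambda>x. frechet_derivative g (at x) v)" for v
    proof (rule Suc.IH)
      show "C_on k S (\<lambda>x. frechet_derivative f (at x) v)" using Suc.prems by simp
    qed (simp add: frechet_derivative_eq[OF D])
    then show ?case using D by (auto simp: differentiable_def)
  qed
  then show ?thesis using assms(2) by metis
qed

lemma C_on_SucI:
  assumes "open S" "\<And>x. x \<in> S \<Longrightarrow> (f has_derivative f' x) (at x)"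
    and "\<And>v. C_on k S (\<lambda>x. f' x v)"
  shows "C_on (Suc k) S f"
proof -
  have "C_on k S (\<lambda>x. frechet_derivative f (at x) v)" for v
    by (rule C_on_cong[THEN iffD1, OF assms(1) _ assms(3)[of v]])
       (simp add: frechet_derivative_eq[OF assms(2)])
  then show ?thesis using assms(2) by (auto simp: differentiable_def)
qed

lemma C_on_SucD: "C_on (Suc k) S f \<Longrightarrow> C_on k S f"
proof (induction k arbitrary: f)
  case 0
  then show ?case
    by (auto intro!: continuous_at_imp_continuous_on differentiable_imp_continuous_within)
qed auto

lemma C_on_const: "open S \<Longrightarrow> C_on k S (\<lambda>x. c)"
proof (induction k arbitrary: c)
  case (Suc k)
  show ?case by (rule C_on_SucI[OF Suc.prems has_derivative_const Suc.IH[OF Suc.prems]])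
qed simp

lemma C_on_linear:
  assumes "open S" "bounded_linear f"
  shows "C_on k S f"
proof (cases k)
  case 0
  then show ?thesis using assms(2) by (simp add: linear_continuous_on)
next
  case (Suc l)
  show ?thesis unfolding Suc
    by (rule C_on_SucI[OF assms(1) bounded_linear_imp_has_derivative[OF assms(2)]])
       (rule C_on_const[OF assms(1)])
qed

lemma C_on_add:
  assumes "open S" "C_on k S f" "C_on k S g"
  shows "C_on k S (\<lambda>x. f x + g x)"
  using assms(2,3)
proof (induction k arbitrary: f g)
  case 0
  then show ?case by (auto intro: continuous_on_add)
next
  case (Suc k)
  show ?case
    by (rule C_on_SucI[OF assms(1) has_derivative_add[OF
        C_on_Suc_has_derivative[OF Suc.prems(1)] C_on_Suc_has_derivative[OF Suc.prems(2)]]])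
       (use Suc in auto)
qed

text \<open>In the Leibniz rule, each term differentiates only one factor, so the other one has to be
  lowered to the same order; this is what \<open>C_on_SucD\<close> provides.\<close>

lemma C_on_bilinear:
  assumes "open S" "bounded_bilinear b" "C_on k S f" "C_on k S g"
  shows "C_on k S (\<lambda>x. b (f x) (g x))"
  using assms(3,4)
proof (induction k arbitrary: f g)
  case 0
  then show ?case using bounded_bilinear.continuous_on[OF assms(2)] by auto
next
  case (Suc k)
  note lower = Suc.prems[THEN C_on_SucD]
  show ?case
    by (rule C_on_SucI[OF assms(1) bounded_bilinear.FDERIV[OF assms(2)
        C_on_Suc_has_derivative[OF Suc.prems(1)] C_on_Suc_has_derivative[OF Suc.prems(2)]]])
       (use Suc.IH lower Suc.prems in \<open>auto intro!: C_on_add[OF assms(1)]\<close>)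
qed

lemmas C_on_mult = C_on_bilinear[OF _ bounded_bilinear_mult]
lemmas C_on_scaleR = C_on_bilinear[OF _ bounded_bilinear_scaleR]

text \<open>Only \<open>h' \<circ> f\<close> enters one order below, so a primitive such as the area function of the
  disc is smooth as soon as its elementary derivative is.\<close>

lemma C_on_chain:
  fixes f :: "'a::euclidean_space \<Rightarrow> real" and h :: "real \<Rightarrow> real"
  assumes "open S" and h: "\<And>x. x \<in> S \<Longrightarrow> (h has_real_derivative h' (f x)) (at (f x))"
    and f: "C_on (Suc k) S f" and h': "C_on k S (\<lambda>x. h' (f x))"
  shows "C_on (Suc k) S (\<lambda>x. h (f x))"
proof (rule C_on_SucI[OF assms(1)])
  show "((\<lambda>x. h (f x)) has_derivative (\<lambda>v. h' (f x) * frechet_derivative f (at x) v)) (at x)"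
    if "x \<in> S" for x
    using has_derivative_compose[OF C_on_Suc_has_derivative[OF f that]
        h[OF that, unfolded has_field_derivative_def]] .
  show "C_on k S (\<lambda>x. h' (f x) * frechet_derivative f (at x) v)" for v
    using f by (auto intro!: C_on_mult[OF assms(1) h'])
qed

text \<open>The exponent varies in the induction, since differentiation lowers it by one. Square roots and
  their inverses are covered by the exponents \<open>1/2\<close> and \<open>-1/2\<close>.\<close>

lemma C_on_powr:
  fixes f :: "'a::euclidean_space \<Rightarrow> real"
  assumes "open S" "C_on k S f" "\<And>x. x \<in> S \<Longrightarrow> f x > 0"
  shows "C_on k S (\<lambda>x. f x powr s)"
  using assms(2)
proof (induction k arbitrary: s)
  case 0
  then show ?case using assms(3) by (force intro!: continuous_on_powr continuous_on_const)
next
  case (Suc k)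
  show ?case
    by (rule C_on_chain[where h = "\<lambda>t. t powr s" and h' = "\<lambda>t. s * t powr (s - 1)",
        OF assms(1) has_real_derivative_powr Suc.prems])
       (use assms(3) C_on_SucD[OF Suc.prems] Suc.IH in
         \<open>auto intro!: C_on_mult[OF assms(1) C_on_const[OF assms(1)]]\<close>)
qed

text \<open>Differentiating the sine is a shift by \<open>\<pi>/2\<close>; with the shift as a parameter the family is
  closed under derivatives, and it contains the cosine.\<close>

lemma C_on_sin_shift:
  fixes f :: "'a::euclidean_space \<Rightarrow> real"
  assumes "open S" "C_on k S f"
  shows "C_on k S (\<lambda>x. sin (f x + t))"
  using assms(2)
proof (induction k arbitrary: t)
  case 0
  then show ?case by (auto intro!: continuous_intros)
next
  case (Suc k)
  have deriv: "((\<lambda>s. sin (s + t)) has_real_derivative sin (u + (t + pi / 2))) (at u)" for u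
  proof -
    have "sin (u + (t + pi / 2)) = cos (u + t)"
      by (simp add: sin_add[of "u + t" "pi / 2"] add.assoc[symmetric])
    then show ?thesis by (auto intro!: derivative_eq_intros)
  qed
  show ?case
    by (rule C_on_chain[where h = "\<lambda>s. sin (s + t)" and h' = "\<lambda>s. sin (s + (t + pi / 2))",
        OF assms(1) deriv Suc.prems Suc.IH[OF C_on_SucD[OF Suc.prems]]])
qed

lemma C_on_sin:
  fixes f :: "'a::euclidean_space \<Rightarrow> real"
  assumes "open S" "C_on k S f"
  shows "C_on k S (\<lambda>x. sin (f x))"
  using C_on_sin_shift[OF assms, of 0] by simp

lemma C_on_cos:
  fixes f :: "'a::euclidean_space \<Rightarrow> real"
  assumes "open S" "C_on k S f"
  shows "C_on k S (\<lambda>x. cos (f x))"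
  using C_on_sin_shift[OF assms, of "pi / 2"] by (simp add: sin_add)

section \<open>Slitting the disc\<close>

text \<open>The fraction of the area of the unit disc to the left of the vertical line through \<open>q\<close>. A disc
  of area \<open>\<pi>\<close> times this fraction has the square root of it as its radius.\<close>

definition disc_fraction :: "real \<Rightarrow> real" where
  "disc_fraction q = 1/2 + (q * sqrt (1 - q\<^sup>2) + arcsin q) / pi"

lemma has_derivative_disc_fraction:
  assumes "\<bar>q\<bar> < 1"
  shows "(disc_fraction has_real_derivative 2 * sqrt (1 - q\<^sup>2) / pi) (at q)"
proof -
  have pos: "0 < 1 - q\<^sup>2" using assms by (simp add: abs_square_less_1)
  have "(disc_fraction has_real_derivative
      (sqrt (1 - q\<^sup>2) + q * (- q / sqrt (1 - q\<^sup>2)) + 1 / sqrt (1 - q\<^sup>2)) / pi) (at q)"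
    unfolding disc_fraction_def[abs_def] using assms pos
    by (auto intro!: derivative_eq_intros simp: field_simps)
  also have "sqrt (1 - q\<^sup>2) + q * (- q / sqrt (1 - q\<^sup>2)) + 1 / sqrt (1 - q\<^sup>2)
      = sqrt (1 - q\<^sup>2) + (1 - q\<^sup>2) / sqrt (1 - q\<^sup>2)"
    by (simp add: diff_divide_distrib power2_eq_square)
  also have "\<dots> = 2 * sqrt (1 - q\<^sup>2)"
    using pos real_div_sqrt[of "1 - q\<^sup>2"] by linarith
  finally show ?thesis .
qed

lemma disc_fraction_strict_mono:
  assumes "-1 \<le> q" "q < r" "r \<le> 1"
  shows "disc_fraction q < disc_fraction r"
proof (rule DERIV_pos_imp_increasing_open[OF assms(2)])
  fix x assume "q < x" "x < r"
  then have "\<bar>x\<bar> < 1" using assms by linarith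
  then have "(disc_fraction has_real_derivative 2 * sqrt (1 - x\<^sup>2) / pi) (at x)"
    and "2 * sqrt (1 - x\<^sup>2) / pi > 0"
    by (simp_all add: has_derivative_disc_fraction abs_square_less_1)
  then show "\<exists>y. (disc_fraction has_real_derivative y) (at x) \<and> 0 < y" by blast
next
  show "continuous_on {q..r} disc_fraction"
    unfolding disc_fraction_def[abs_def] using assms by (intro continuous_intros) auto
qed

lemma disc_fraction_bounds:
  assumes "\<bar>q\<bar> < 1"
  shows "0 < disc_fraction q" "disc_fraction q < 1"
proof -
  have "disc_fraction (-1) = 0" "disc_fraction 1 = 1"
    by (simp_all add: disc_fraction_def)
  then show "0 < disc_fraction q" "disc_fraction q < 1"
    using disc_fraction_strict_mono[of "-1" q] disc_fraction_strict_mono[of q 1] assms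
    by (auto simp: abs_less_iff)
qed

lemma disc_fraction_inj:
  assumes "\<bar>q\<bar> < 1" "\<bar>r\<bar> < 1" "disc_fraction q = disc_fraction r"
  shows "q = r"
  using disc_fraction_strict_mono[of q r] disc_fraction_strict_mono[of r q] assms
  by (cases q r rule: linorder_cases) (auto simp: abs_less_iff)

text \<open>The position of \<open>p\<close> in the vertical chord through \<open>q\<close>, scaled to an angle in \<open>(-\<pi>, \<pi>)\<close>. With
  half of \<open>disc_fraction q\<close> as the conjugate action it gives area-preserving coordinates, since
  \<open>dR/dq\<close> for \<open>R = disc_fraction q\<close> is proportional to the chord length and the
  derivative of the angle in \<open>p\<close> is inversely proportional to it.\<close>

definition slit_angle :: "real \<Rightarrow> real \<Rightarrow> real" where
  "slit_angle q p = pi * p / sqrt (1 - q\<^sup>2)"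

lemma slit_angle_bounds:
  assumes "q\<^sup>2 + p\<^sup>2 < 1"
  shows "\<bar>slit_angle q p\<bar> < pi"
proof -
  have "\<bar>p\<bar> = sqrt (p\<^sup>2)" by simp
  also have "\<dots> < sqrt (1 - q\<^sup>2)" using assms by (intro real_sqrt_less_mono) simp
  finally have "\<bar>p\<bar> < sqrt (1 - q\<^sup>2)" .
  moreover from this have "0 < sqrt (1 - q\<^sup>2)" by linarith
  ultimately show ?thesis by (simp add: slit_angle_def abs_mult pos_divide_less_eq)
qed

definition polar :: "real \<Rightarrow> real \<Rightarrow> plane" where
  "polar r t = (r * cos t, r * sin t)"

lemma norm_polar: "norm (polar r t) = \<bar>r\<bar>"
proof -
  have "(r * cos t)\<^sup>2 + (r * sin t)\<^sup>2 = r\<^sup>2"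
    by (simp add: power_mult_distrib distrib_left[symmetric])
  then show ?thesis by (simp add: polar_def norm_Pair)
qed

lemma polar_eq_imp:
  assumes "polar r s = polar r' t" "0 < r" "0 \<le> r'"
  obtains n :: int where "r = r'" "s = t + 2 * pi * n"
proof -
  have "r = r'" using assms norm_polar[of r s] norm_polar[of r' t] by simp
  then have "sin s = sin t \<and> cos s = cos t" using assms by (simp add: polar_def)
  then show ?thesis using that \<open>r = r'\<close> sin_cos_eq_iff by metis
qed

lemma has_derivative_polar:
  assumes "(r has_derivative r') (at x)" "(t has_derivative t') (at x)"
  shows "((\<lambda>x. polar (r x) (t x)) has_derivative
    (\<lambda>v. (r' v * cos (t x) - r x * sin (t x) * t' v,
         r' v * sin (t x) + r x * cos (t x) * t' v))) (at x)"
  unfolding polar_def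
  by (rule has_derivative_Pair; rule has_derivative_eq_rhs,
      (rule derivative_intros assms)+, simp add: algebra_simps)

section \<open>Sections of thin slit annuli\<close>

text \<open>A set that lies in a rotation-invariant set and misses a ray from the origin cannot enclose
  points outside the invariant set: the circle through such a point and the ray form a
  connected unbounded set in the complement.\<close>

lemma bounded_hull_slit:
  fixes S :: "plane set"
  assumes inv: "\<And>x y. norm x = norm y \<Longrightarrow> x \<in> A \<Longrightarrow> y \<in> A"
    and "S \<subseteq> A" and slit: "\<And>r. 0 \<le> r \<Longrightarrow> polar r t \<notin> S"
  shows "bounded_hull S \<subseteq> A"
proof
  fix y assume "y \<in> bounded_hull S"
  then have y: "y \<in> S \<union> inside S" by (simp add: bounded_hull_eq_inside)
  show "y \<in> A"
  proof (rule ccontr)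
    assume "y \<notin> A"
    let ?ray = "(\<lambda>r. polar r t) ` {0..}"
    let ?C = "sphere 0 (norm y) \<union> ?ray"
    have "connected (sphere (0::plane) (norm y))"
      by (intro connected_sphere) simp
    moreover have "connected ?ray"
      unfolding polar_def by (intro connected_continuous_image continuous_intros) simp
    moreover have "polar (norm y) t \<in> sphere 0 (norm y) \<inter> ?ray"
      by (simp add: norm_polar)
    ultimately have "connected ?C" by (intro connected_Un) blast+
    moreover have "?C \<subseteq> - S"
      using slit assms(2) inv[of _ y] \<open>y \<notin> A\<close> by fastforce
    moreover have "y \<in> ?C" by simp
    ultimately have C: "?C \<subseteq> connected_component_set (- S) y"
      by (intro connected_component_maximal)
    have "y \<in> inside S" using y \<open>y \<notin> A\<close> assms(2) by blast
    then have "bounded (connected_component_set (- S) y)" by (simp add: inside_def)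
    then have "bounded ?ray" using C bounded_subset by (meson Un_subset_iff)
    then obtain b where b: "\<And>r. 0 \<le> r \<Longrightarrow> norm (polar r t) \<le> b"
      by (auto simp: bounded_iff)
    show False using b[of "\<bar>b\<bar> + 1"] by (simp add: norm_polar)
  qed
qed

lemma emeasure_annulus:
  fixes s t :: real
  assumes "s \<le> t"
  shows "{y::plane. s < (norm y)\<^sup>2 \<and> (norm y)\<^sup>2 < t} \<in> sets lebesgue" (is "?A \<in> _")
    and "emeasure lebesgue {y::plane. s < (norm y)\<^sup>2 \<and> (norm y)\<^sup>2 < t} \<le> ennreal (pi * (t - s))"
proof -
  have "open {y::plane. s < (norm y)\<^sup>2}" "open {y::plane. (norm y)\<^sup>2 < t}"
    by (intro open_Collect_less continuous_intros)+
  then have "open ?A" by (simp add: open_Int Collect_conj_eq)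
  then show "?A \<in> sets lebesgue" by simp
  show "emeasure lebesgue ?A \<le> ennreal (pi * (t - s))"
  proof (cases "t \<le> 0")
    case True
    have "\<not> (norm y)\<^sup>2 < t" for y :: plane using True zero_le_power2[of "norm y"] by linarith
    then have "?A = {}" by blast
    then show ?thesis by (simp only: emeasure_empty zero_le)
  next
    case False
    (* For negative s the inner disc is empty. *)
    define s' where "s' = max s 0"
    have s': "0 \<le> s'" "s' \<le> t" "s \<le> s'" using False assms by (auto simp: s'_def)
    let ?big = "ball (0::plane) (sqrt t)" and ?small = "ball (0::plane) (sqrt s')"
    have "?A \<subseteq> ?big - ?small"
    proof
      fix y assume y: "y \<in> ?A"
      have "s' \<le> (norm y)\<^sup>2" using y by (auto simp: s'_def)
      then have "sqrt s' \<le> norm y" by (simp add: real_le_lsqrt)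
      moreover have "norm y < sqrt t" using y by (simp add: real_less_rsqrt)
      ultimately show "y \<in> ?big - ?small" by simp
    qed
    then have "emeasure lebesgue ?A \<le> emeasure lebesgue (?big - ?small)"
      by (intro emeasure_mono) auto
    also have "\<dots> = emeasure lebesgue ?big - emeasure lebesgue ?small"
      using s' by (intro emeasure_Diff) (auto intro!: subset_ball simp: emeasure_ball)
    also have "\<dots> = ennreal (pi * t) - ennreal (pi * s')"
      using s' False by (simp add: emeasure_ball unit_ball_vol_2)
    also have "\<dots> = ennreal (pi * t - pi * s')"
      using s' by (simp add: ennreal_minus)
    also have "\<dots> \<le> ennreal (pi * (t - s))"
      using s' by (intro ennreal_leI) (simp add: right_diff_distrib)
    finally show ?thesis .
  qed
qed

section \<open>The embedding\<close>

text \<open>The slitting map on the first plane followed by the flow of \<open>- k \<bar>y\<bar>\<^sup>2 q\<close> with \<open>q\<close> the first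
  coordinate of the \<open>i\<close>-th further plane. The squared radius after slitting is \<open>disc_fraction q\<close>. The
  factor 2 in the angle is due to the action being half of the squared radius.\<close>

definition wrap :: "real \<Rightarrow> 'm::finite \<Rightarrow> 'm phase_space \<Rightarrow> 'm phase_space" where
  "wrap k i = (\<lambda>((q, p), z).
     (polar (sqrt (disc_fraction q)) (slit_angle q p + 2 * k * fst (z $ i)),
      z + (k * disc_fraction q) *\<^sub>R axis i (0, 1)))"

lemma mem_disc_cylinder:
  "((q, p), z) \<in> ball (0::plane) 1 \<times> UNIV \<longleftrightarrow> q\<^sup>2 + p\<^sup>2 < 1"
  by (simp add: norm_Pair)

lemma disc_imp_abs_less_1:
  fixes q p :: real
  assumes "q\<^sup>2 + p\<^sup>2 < 1"
  shows "\<bar>q\<bar> < 1"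
proof -
  have "q\<^sup>2 < 1" using assms zero_le_power2[of p] by linarith
  then show ?thesis by (simp add: abs_square_less_1)
qed

lemma smooth_on_wrap:
  fixes S :: "'m::finite phase_space set"
  assumes "open S" "S \<subseteq> ball 0 1 \<times> UNIV"
  shows "smooth_on S (wrap k i)"
  unfolding smooth_on_def
proof
  fix n
  let ?q = "\<lambda>x::'m phase_space. fst (fst x)" and ?p = "\<lambda>x::'m phase_space. snd (fst x)"
  note C_intros = C_on_add[OF assms(1)] C_on_mult[OF assms(1)] C_on_scaleR[OF assms(1)]
    C_on_const[OF assms(1)] C_on_sin[OF assms(1)] C_on_cos[OF assms(1)]
  have q: "\<bar>?q x\<bar> < 1" if "x \<in> S" for x
  proof (rule disc_imp_abs_less_1)
    have "((?q x, ?p x), snd x) \<in> ball 0 1 \<times> UNIV" using assms(2) that by auto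
    then show "(?q x)\<^sup>2 + (?p x)\<^sup>2 < 1" unfolding mem_disc_cylinder .
  qed
  have pos: "0 < 1 + -1 * (?q x * ?q x)" if "x \<in> S" for x
    using q[OF that] by (simp add: abs_square_less_1 flip: power2_eq_square)
  have linear: "bounded_linear ?q" "bounded_linear ?p" "bounded_linear (\<lambda>x. fst (snd x $ i))"
    "bounded_linear (\<lambda>x::'m phase_space. (0::plane, snd x))"
    by (intro bounded_linear_intros bounded_linear_fst_comp bounded_linear_snd_comp
        bounded_linear_Pair bounded_linear_zero
        bounded_linear_compose[OF bounded_linear_vec_nth])+
  note C_linear = linear[THEN C_on_linear[OF assms(1)]]
  have powr: "C_on n S (\<lambda>x. (1 + -1 * (?q x * ?q x)) powr s)" for n s
    using pos by (intro C_on_powr C_intros C_linear assms(1))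
  have R: "C_on n S (\<lambda>x. disc_fraction (?q x))" for n
  proof (rule C_on_SucD, rule C_on_chain[where h = disc_fraction
        and h' = "\<lambda>t. 2 * sqrt (1 - t\<^sup>2) / pi", OF assms(1)])
    show "(disc_fraction has_real_derivative 2 * sqrt (1 - (?q x)\<^sup>2) / pi) (at (?q x))"
      if "x \<in> S" for x
      using has_derivative_disc_fraction[OF q[OF that]] .
    have "C_on n S (\<lambda>x. (2 / pi) * (1 + -1 * (?q x * ?q x)) powr (1/2))"
      by (intro C_intros powr)
    then show "C_on n S (\<lambda>x. 2 * sqrt (1 - (?q x)\<^sup>2) / pi)"
      by (rule C_on_cong[THEN iffD1, OF assms(1), rotated])
         (use pos in \<open>simp add: powr_half_sqrt power2_eq_square less_imp_le\<close>)
  qed (rule C_linear)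
  have r: "C_on n S (\<lambda>x. disc_fraction (?q x) powr (1/2))"
    using C_on_powr[OF assms(1) R] disc_fraction_bounds(1)[OF q] .
  define \<phi> where "\<phi> x = pi * ?p x * (1 + -1 * (?q x * ?q x)) powr (-1/2)
    + 2 * k * fst (snd x $ i)" for x :: "'m phase_space"
  have \<phi>: "C_on n S \<phi>"
    unfolding \<phi>_def[abs_def] by (intro C_intros C_linear powr)
  (* Over the disc the roots and quotients of the definition are real powers of
     positive functions. *)
  have "C_on n S (\<lambda>x. ((0, snd x) :: 'm phase_space)
      + (disc_fraction (?q x) powr (1/2) * cos (\<phi> x)) *\<^sub>R ((1, 0), 0)
      + (disc_fraction (?q x) powr (1/2) * sin (\<phi> x)) *\<^sub>R ((0, 1), 0)
      + (k * disc_fraction (?q x)) *\<^sub>R (0, axis i (0, 1)))"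
    by (intro C_intros C_linear(4) r R \<phi>)
  then show "C_on n S (wrap k i)"
  proof (rule C_on_cong[THEN iffD1, OF assms(1), rotated])
    fix x assume x: "x \<in> S"
    have "(1 + -1 * (?q x * ?q x)) powr (-1/2) = 1 / sqrt (1 - (?q x)\<^sup>2)"
      using pos[OF x] powr_minus_divide[of "1 + -1 * (?q x * ?q x)" "1/2"]
      by (simp add: powr_half_sqrt power2_eq_square)
    then have "\<phi> x = slit_angle (?q x) (?p x) + 2 * k * fst (snd x $ i)"
      by (simp add: \<phi>_def slit_angle_def)
    then show "(0, snd x)
      + (disc_fraction (?q x) powr (1/2) * cos (\<phi> x)) *\<^sub>R ((1, 0), 0)
      + (disc_fraction (?q x) powr (1/2) * sin (\<phi> x)) *\<^sub>R ((0, 1), 0)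
      + (k * disc_fraction (?q x)) *\<^sub>R (0, axis i (0, 1)) = wrap k i x"
      using disc_fraction_bounds(1)[OF q[OF x]]
      by (simp add: wrap_def polar_def powr_half_sqrt case_prod_unfold)
  qed
qed

lemma omega0_shift:
  fixes z w :: "plane ^ 'm::finite"
  shows "omega0 (a, z + s *\<^sub>R axis i (0, 1)) (b, w + t *\<^sub>R axis i (0, 1))
    = omega0 (a, z) (b, w) + (fst (z $ i) * t - fst (w $ i) * s)"
proof -
  have fst: "fst (axis i (0, 1) $ j) = (0::real)" for j
    by (simp add: axis_def)
  have snd: "snd (axis i (0, 1) $ j) = (if j = i then 1 else (0::real))" for j
    by (simp add: axis_def)
  have "(\<Sum>j\<in>UNIV. fst (z $ j) * (snd (w $ j) + t * (if j = i then 1 else 0))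
        - fst (w $ j) * (snd (z $ j) + s * (if j = i then 1 else 0)))
    = (\<Sum>j\<in>UNIV. (fst (z $ j) * snd (w $ j) - fst (w $ j) * snd (z $ j))
        + (if j = i then fst (z $ j) * t - fst (w $ j) * s else 0))"
    by (intro sum.cong) (auto simp: algebra_simps)
  then show ?thesis
    by (simp add: omega0_def wedge_def fst snd sum.distrib)
qed

text \<open>The form is tested against the image of \<open>u\<close> under the standard complex structure, which gives
  the squared norm of \<open>u\<close>.\<close>

lemma omega0_nondegenerate:
  fixes u :: "'m::finite phase_space"
  assumes "\<And>v. omega0 u v = 0"
  shows "u = 0"
proof -
  let ?v = "((- snd (fst u), fst (fst u)), \<chi> j. (- snd (snd u $ j), fst (snd u $ j)))"
  have sum: "(fst (fst u))\<^sup>2 + (snd (fst u))\<^sup>2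
      + (\<Sum>j\<in>UNIV. (fst (snd u $ j))\<^sup>2 + (snd (snd u $ j))\<^sup>2) = 0"
    using assms[of ?v] by (simp add: omega0_def wedge_def power2_eq_square)
  have nonneg: "0 \<le> (\<Sum>j\<in>UNIV. (fst (snd u $ j))\<^sup>2 + (snd (snd u $ j))\<^sup>2)"
    by (intro sum_nonneg) simp
  have "(fst (fst u))\<^sup>2 + (snd (fst u))\<^sup>2 = 0"
    using sum nonneg zero_le_power2[of "fst (fst u)"] zero_le_power2[of "snd (fst u)"] by linarith
  moreover from this have "(\<Sum>j\<in>UNIV. (fst (snd u $ j))\<^sup>2 + (snd (snd u $ j))\<^sup>2) = 0"
    using sum by simp
  then have "(fst (snd u $ j))\<^sup>2 + (snd (snd u $ j))\<^sup>2 = 0" for j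
    by (subst (asm) sum_nonneg_eq_0_iff) auto
  ultimately show ?thesis
    by (simp add: prod_eq_iff vec_eq_iff sum_power2_eq_zero_iff)
qed

lemma omega0_diff_left: "omega0 (u - v) w = omega0 u w - omega0 v w"
proof -
  have wedge: "wedge \<alpha> \<beta> (u - v) w = wedge \<alpha> \<beta> u w - wedge \<alpha> \<beta> v w"
    if "\<alpha> (u - v) = \<alpha> u - \<alpha> v" "\<beta> (u - v) = \<beta> u - \<beta> v" for \<alpha> \<beta>
    unfolding wedge_def that by (simp add: algebra_simps)
  show ?thesis
    unfolding omega0_def by (simp add: wedge sum_subtractf)
qed

lemma has_derivative_slit_angle:
  assumes "\<bar>q\<bar> < 1"
  shows "((\<lambda>y. slit_angle (fst y) (snd y)) has_derivative
    (\<lambda>v. pi * p * q / sqrt (1 - q\<^sup>2) ^ 3 * fst v + pi / sqrt (1 - q\<^sup>2) * snd v)) (at (q, p))"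
proof -
  have pos: "0 < 1 - q\<^sup>2" using assms by (simp add: abs_square_less_1)
  define s where "s = sqrt (1 - q\<^sup>2)"
  have s: "s > 0" using pos by (simp add: s_def)
  have "((\<lambda>y::plane. sqrt (1 - (fst y)\<^sup>2)) has_derivative (\<lambda>v. - q / s * fst v)) (at (q, p))"
    using pos by (auto intro!: derivative_eq_intros simp: s_def field_simps)
  moreover have "((\<lambda>y::plane. pi * snd y) has_derivative (\<lambda>v. pi * snd v)) (at (q, p))"
    by (auto intro!: derivative_eq_intros)
  ultimately have "((\<lambda>y. pi * snd y / sqrt (1 - (fst y)\<^sup>2)) has_derivative
      (\<lambda>v. (pi * snd v * s - pi * p * (- q / s * fst v)) / (s * s))) (at (q, p))"
    using has_derivative_divide'[of "\<lambda>y. pi * snd y" "\<lambda>v. pi * snd v" "(q, p)" UNIV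
        "\<lambda>y. sqrt (1 - (fst y)\<^sup>2)" "\<lambda>v. - q / s * fst v"] s
    by (simp flip: s_def)
  moreover have "(\<lambda>v. (pi * snd v * s - pi * p * (- q / s * fst v)) / (s * s))
      = (\<lambda>v. pi * p * q / s ^ 3 * fst v + pi / s * snd v)"
    using s by (intro ext) (simp add: field_simps power3_eq_cube)
  ultimately show ?thesis by (simp add: slit_angle_def s_def)
qed

text \<open>In polar coordinates the form of the first plane is \<open>dR \<and> d\<phi> / 2\<close> with \<open>R\<close> the squared radius.
  The part of \<open>\<phi>\<close> from the slitting map contributes the original form. The part \<open>2 k q\<^sub>i\<close>
  contributes \<open>k dR \<and> dq\<^sub>i\<close>, which cancels against the term \<open>dq\<^sub>i \<and> k dR\<close> from the shift of
  \<open>p\<^sub>i\<close>.\<close>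

lemma wrap_preserves_omega0:
  fixes x :: "'m::finite phase_space"
  assumes "x \<in> ball 0 1 \<times> UNIV"
  obtains D where "(wrap k i has_derivative D) (at x)"
    and "\<And>u v. omega0 (D u) (D v) = omega0 u v"
proof -
  obtain q p z where x: "x = ((q, p), z)" by (metis prod.collapse)
  have q: "\<bar>q\<bar> < 1" using assms disc_imp_abs_less_1 unfolding x mem_disc_cylinder by blast
  (* m is the derivative of R = disc_fraction in q; the derivative of the angle in p is 2 / m. The
     coefficient e of its derivative in q cancels in the form. *)
  define m where "m = 2 * sqrt (1 - q\<^sup>2) / pi"
  define e where "e = pi * p * q / sqrt (1 - q\<^sup>2) ^ 3"
  define r where "r = sqrt (disc_fraction q)"
  define \<phi> where "\<phi> = slit_angle q p + 2 * k * fst (z $ i)"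
  define dr where "dr v = m / (2 * r) * fst (fst v)" for v :: "'m phase_space"
  define d\<phi> where "d\<phi> v = e * fst (fst v) + 2 / m * snd (fst v) + 2 * k * fst (snd v $ i)"
    for v :: "'m phase_space"
  define D where "D v = ((dr v * cos \<phi> - r * sin \<phi> * d\<phi> v, dr v * sin \<phi> + r * cos \<phi> * d\<phi> v),
      snd v + (k * (m * fst (fst v))) *\<^sub>R axis i (0, 1))" for v :: "'m phase_space"
  have m: "m > 0" using q by (simp add: m_def abs_square_less_1)
  have r: "r > 0" using disc_fraction_bounds(1)[OF q] by (simp add: r_def)
  have dR: "(disc_fraction has_derivative (\<lambda>t. m * t)) (at q)"
    using has_derivative_disc_fraction[OF q] unfolding has_field_derivative_def m_def .
  have dR': "((\<lambda>x. disc_fraction (fst (fst x))) has_derivative (\<lambda>v. m * fst (fst v))) (at x)"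
    using has_derivative_compose[of "\<lambda>x. fst (fst x)" "\<lambda>v. fst (fst v)" x UNIV disc_fraction] dR
    by (simp add: x has_derivative_fst)
  have dr: "((\<lambda>x. sqrt (disc_fraction (fst (fst x)))) has_derivative dr) (at x)"
    unfolding dr_def[abs_def] using disc_fraction_bounds(1)[OF q]
    by (auto intro!: derivative_eq_intros dR'[unfolded x] simp: x r_def field_simps)
  have dslit: "((\<lambda>x. slit_angle (fst (fst x)) (snd (fst x))) has_derivative
      (\<lambda>v. e * fst (fst v) + 2 / m * snd (fst v))) (at x)"
    using has_derivative_compose[of fst fst x UNIV "\<lambda>y. slit_angle (fst y) (snd y)"]
      has_derivative_slit_angle[OF q, of p]
    by (simp add: x has_derivative_fst e_def m_def)
  have dz: "((\<lambda>x. fst (snd x $ i)) has_derivative (\<lambda>v. fst (snd v $ i))) (at x)"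
    by (intro bounded_linear_imp_has_derivative bounded_linear_fst_comp bounded_linear_snd_comp
        bounded_linear_compose[OF bounded_linear_vec_nth] bounded_linear_snd)
  have d\<phi>: "((\<lambda>x. slit_angle (fst (fst x)) (snd (fst x)) + 2 * k * fst (snd x $ i))
      has_derivative d\<phi>) (at x)"
    unfolding d\<phi>_def[abs_def] by (intro has_derivative_add dslit has_derivative_mult_right dz)
  have "(wrap k i has_derivative D) (at x)"
    using has_derivative_Pair[OF has_derivative_polar[OF dr d\<phi>]
        has_derivative_add[OF has_derivative_snd[OF has_derivative_ident]
          has_derivative_scaleR_left[OF has_derivative_mult_right[OF dR', of k], of "axis i (0, 1)"]]]
    unfolding wrap_def case_prod_unfold D_def[abs_def] \<phi>_def r_def by (simp add: x)
  moreover have "omega0 (D u) (D v) = omega0 u v" for u v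
  proof -
    have "wedge fst snd (fst (D u)) (fst (D v))
        = r * (dr u * d\<phi> v - dr v * d\<phi> u) * ((sin \<phi>)\<^sup>2 + (cos \<phi>)\<^sup>2)"
      unfolding D_def wedge_def fst_conv snd_conv by algebra
    also have "\<dots> = wedge fst snd (fst u) (fst v)
        + k * m * (fst (fst u) * fst (snd v $ i) - fst (fst v) * fst (snd u $ i))"
      using m r by (simp add: dr_def d\<phi>_def wedge_def field_simps)
    finally show ?thesis
      using omega0_shift[of "fst (D u)" "snd u" "k * (m * fst (fst u))" i
          "fst (D v)" "snd v" "k * (m * fst (fst v))"]
      by (simp add: omega0_def D_def wedge_def algebra_simps)
  qed
  ultimately show ?thesis using that by blast
qed

text \<open>The radius determines \<open>q\<close>, and then the last component of the image determines \<open>z\<close>. What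
  remains is the angle modulo \<open>2\<pi>\<close>, which is unambiguous because two values of \<open>slit_angle\<close> differ by
  less than \<open>2\<pi>\<close>.\<close>

lemma inj_on_wrap: "inj_on (wrap k i) (ball 0 1 \<times> UNIV)"
proof (rule inj_onI)
  fix x x' :: "'a phase_space"
  assume "x \<in> ball 0 1 \<times> UNIV" "x' \<in> ball 0 1 \<times> UNIV" and eq: "wrap k i x = wrap k i x'"
  moreover obtain q p z q' p' z' where x: "x = ((q, p), z)" "x' = ((q', p'), z')"
    by (metis prod.collapse)
  ultimately have disc: "q\<^sup>2 + p\<^sup>2 < 1" "q'\<^sup>2 + p'\<^sup>2 < 1"
    unfolding x mem_disc_cylinder by blast+
  note q = disc[THEN disc_imp_abs_less_1]
  have "0 < sqrt (disc_fraction q)" "0 \<le> sqrt (disc_fraction q')"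
    using q[THEN disc_fraction_bounds(1)] by simp_all
  then obtain n :: int where r: "sqrt (disc_fraction q) = sqrt (disc_fraction q')"
    and n: "slit_angle q p + 2 * k * fst (z $ i)
      = slit_angle q' p' + 2 * k * fst (z' $ i) + 2 * pi * n"
    using eq by (auto simp: x wrap_def elim: polar_eq_imp)
  have "q = q'" using disc_fraction_inj[OF q] r by simp
  moreover from this have "z = z'" using eq by (simp add: x wrap_def)
  moreover have "p = p'"
  proof -
    have "\<bar>2 * pi * n\<bar> < 2 * pi"
      using n \<open>z = z'\<close> slit_angle_bounds[OF disc(1)] slit_angle_bounds[OF disc(2)] by simp
    then have "n = 0" by (simp add: abs_mult)
    then have "slit_angle q p = slit_angle q p'" using n \<open>z = z'\<close> \<open>q = q'\<close> by simp
    moreover have "sqrt (1 - q\<^sup>2) > 0" using q by (simp add: abs_square_less_1)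
    ultimately show ?thesis by (simp add: slit_angle_def)
  qed
  ultimately show "x = x'" by (simp add: x)
qed

lemma symplectic_embedding_wrap:
  fixes S :: "'m::finite phase_space set"
  assumes "open S" "S \<subseteq> ball 0 1 \<times> UNIV"
  shows "symplectic_embedding S (ball 0 1 \<times> UNIV) (wrap k i)"
proof -
  have image: "wrap k i ` S \<subseteq> ball 0 1 \<times> UNIV"
  proof
    fix y assume "y \<in> wrap k i ` S"
    then obtain q p z where "((q, p), z) \<in> S" and y: "y = wrap k i ((q, p), z)" by auto
    then have "((q, p), z) \<in> ball 0 1 \<times> UNIV" using assms(2) by blast
    then have "\<bar>q\<bar> < 1" unfolding mem_disc_cylinder by (rule disc_imp_abs_less_1)
    then show "y \<in> ball 0 1 \<times> UNIV"
      using disc_fraction_bounds[of q] by (simp add: y wrap_def norm_polar)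
  qed
  have omega: "omega0 (frechet_derivative (wrap k i) (at x) u)
      (frechet_derivative (wrap k i) (at x) v) = omega0 u v" if x: "x \<in> S" for x u v
  proof -
    obtain D where "(wrap k i has_derivative D) (at x)" "\<And>u v. omega0 (D u) (D v) = omega0 u v"
      using wrap_preserves_omega0 subsetD[OF assms(2) x] by metis
    then show ?thesis by (simp add: frechet_derivative_eq)
  qed
  have "inj (frechet_derivative (wrap k i) (at x))" if "x \<in> S" for x
  proof (rule injI)
    fix u v assume eq: "frechet_derivative (wrap k i) (at x) u = frechet_derivative (wrap k i) (at x) v"
    have "omega0 (u - v) w = 0" for w
      using omega[OF that, of u w] omega[OF that, of v w] eq by (simp add: omega0_diff_left)
    then show "u = v" using omega0_nondegenerate[of "u - v"] by simp
  qed
  moreover have smooth: "smooth_on S (wrap k i)" using smooth_on_wrap[OF assms] .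
  moreover have "\<exists>g. homeomorphism S (wrap k i ` S) (wrap k i) g"
  proof -
    have "continuous_on S (wrap k i)"
      using smooth C_on.simps(1) unfolding smooth_on_def by blast
    then show ?thesis
      using invariance_of_domain_homeomorphism[OF assms(1)] inj_on_subset[OF inj_on_wrap assms(2)]
      by (metis order_refl)
  qed
  ultimately show ?thesis
    using image omega assms(1)
    by (simp add: symplectic_embedding_def smooth_embedding_on_def open_Times)
qed

text \<open>The shift leaves the first coordinate of the \<open>i\<close>-th plane unchanged, so over a fixed
  \<open>z\<close> the flow is a single rotation, and the rotated slit is a ray in direction
  \<open>\<pi> + 2 k fst (z $ i)\<close>.\<close>

lemma section_wrap:
  assumes "k > 0"
  shows "emeasure lebesgue (bounded_hull (iota z -` (wrap k i ` ball 0 1))) \<le> ennreal (2 * pi / k)"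
proof -
  let ?S = "iota z -` (wrap k i ` ball 0 1)"
  let ?c = "snd (z $ i)"
  define A where "A = {y::plane. (?c - 1) / k < (norm y)\<^sup>2 \<and> (norm y)\<^sup>2 < (?c + 1) / k}"
  have preimage: "\<exists>q p. \<bar>q\<bar> < 1 \<and> \<bar>slit_angle q p\<bar> < pi \<and> \<bar>?c - k * disc_fraction q\<bar> < 1
      \<and> y = polar (sqrt (disc_fraction q)) (slit_angle q p + 2 * k * fst (z $ i))"
    if y: "y \<in> ?S" for y
  proof -
    obtain q p w where qpw: "norm ((q, p), w) < 1" and eq: "(y, z) = wrap k i ((q, p), w)"
    proof -
      obtain x where "x \<in> ball 0 1" "(y, z) = wrap k i x"
        using y by (auto simp: iota_def)
      then show ?thesis using that by (cases x) auto
    qed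
    have "norm (q, p) < 1" "norm w < 1"
      using qpw norm_fst_le[of "(q, p)" w] norm_snd_le[of w "(q, p)"] by linarith+
    then have qp: "q\<^sup>2 + p\<^sup>2 < 1" by (simp add: norm_Pair)
    have "\<bar>snd (w $ i)\<bar> \<le> norm w"
      using norm_snd_le[of "snd (w $ i)" "fst (w $ i)"]
        Finite_Cartesian_Product.norm_nth_le[of w i] by simp
    then have "\<bar>snd (w $ i)\<bar> < 1" using \<open>norm w < 1\<close> by linarith
    moreover have "snd (w $ i) = ?c - k * disc_fraction q" "fst (w $ i) = fst (z $ i)"
      using eq by (simp_all add: wrap_def axis_def)
    moreover from this have
      "y = polar (sqrt (disc_fraction q)) (slit_angle q p + 2 * k * fst (z $ i))"
      using eq by (simp add: wrap_def)
    ultimately show ?thesis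
      using slit_angle_bounds[OF qp] disc_imp_abs_less_1[OF qp] by metis
  qed
  have "bounded_hull ?S \<subseteq> A"
  proof (rule bounded_hull_slit)
    show "?S \<subseteq> A"
    proof
      fix y assume "y \<in> ?S"
      from preimage[OF this] obtain q p where "\<bar>q\<bar> < 1" and c: "\<bar>?c - k * disc_fraction q\<bar> < 1"
        and y: "y = polar (sqrt (disc_fraction q)) (slit_angle q p + 2 * k * fst (z $ i))" by blast
      then have "(norm y)\<^sup>2 = disc_fraction q"
        using disc_fraction_bounds(1)[of q] by (simp add: norm_polar)
      moreover have "(?c - 1) / k < disc_fraction q" "disc_fraction q < (?c + 1) / k"
        using c assms by (simp_all add: pos_divide_less_eq pos_less_divide_eq mult.commute[of _ k])
      ultimately show "y \<in> A" by (simp add: A_def)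
    qed
    show "polar r (pi + 2 * k * fst (z $ i)) \<notin> ?S" if "0 \<le> r" for r
    proof
      assume "polar r (pi + 2 * k * fst (z $ i)) \<in> ?S"
      from preimage[OF this] obtain q p where "\<bar>q\<bar> < 1" and angle: "\<bar>slit_angle q p\<bar> < pi"
        and eq: "polar r (pi + 2 * k * fst (z $ i))
          = polar (sqrt (disc_fraction q)) (slit_angle q p + 2 * k * fst (z $ i))" by blast
      have "0 < sqrt (disc_fraction q)"
        using disc_fraction_bounds(1) \<open>\<bar>q\<bar> < 1\<close> by simp
      from polar_eq_imp[OF eq[symmetric] this that] obtain n :: int where
        "slit_angle q p + 2 * k * fst (z $ i) = pi + 2 * k * fst (z $ i) + 2 * pi * n"
        by metis
      then have "slit_angle q p = pi * (1 + 2 * n)" by (simp add: algebra_simps)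
      then have "pi * \<bar>1 + 2 * real_of_int n\<bar> < pi * 1"
        using angle by (simp add: abs_mult)
      then have "\<bar>1 + 2 * real_of_int n\<bar> < 1"
        by (simp only: mult_less_cancel_left_pos[OF pi_gt_zero])
      then have "\<bar>1 + 2 * n\<bar> < 1" by linarith
      then show False by presburger
    qed
  qed (simp add: A_def)
  then have "emeasure lebesgue (bounded_hull ?S) \<le> emeasure lebesgue A"
    using assms by (intro emeasure_mono) (auto simp: A_def intro!: emeasure_annulus(1) divide_right_mono)
  also have "\<dots> \<le> ennreal (pi * ((?c + 1) / k - (?c - 1) / k))"
    using assms unfolding A_def by (intro emeasure_annulus(2) divide_right_mono) auto
  also have "pi * ((?c + 1) / k - (?c - 1) / k) = 2 * pi / k"
    by (simp flip: diff_divide_distrib)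
  finally show ?thesis .
qed

theorem corollary5:
  fixes a :: real
  assumes "a > 0"
  shows "\<exists>\<psi> :: 'm::finite phase_space \<Rightarrow> 'm phase_space.
    symplectic_embedding (ball 0 1) (ball 0 1 \<times> UNIV) \<psi> \<and>
    (\<forall>z. emeasure lebesgue (bounded_hull (iota z -` (\<psi> ` ball 0 1))) \<le> ennreal a)"
proof -
  obtain i :: 'm where True by blast
  have "ball 0 1 \<subseteq> ball (0::plane) 1 \<times> (UNIV :: (plane ^ 'm) set)"
    using norm_fst_le order_le_less_trans by (fastforce simp: mem_Times_iff)
  then have "symplectic_embedding (ball 0 1) (ball 0 1 \<times> UNIV) (wrap (2 * pi / a) i)"
    by (simp add: symplectic_embedding_wrap)
  moreover have "emeasure lebesgue (bounded_hull (iota z -` (wrap (2 * pi / a) i ` ball 0 1)))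
      \<le> ennreal a" for z
    using section_wrap[of "2 * pi / a" z i] assms by simp
  ultimately show ?thesis by blast
qed

end
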